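(* There exists a continuous quadratic form on the (real) space $\ell_1$ which is not delta-convex.
   Context: A function $q\colon X\to\mathbb{R}$ on a real Banach space $X$ is a continuous quadratic form if there is a continuous bilinear form $b\colon X\times X\to\mathbb{R}$ with $q(x)=b(x,x)$ for all $x$. A function on $X$ is delta-convex if it is the difference of two continuous convex functions on $X$. *)

theory Defs
  imports "HOL-Analysis.Analysis"
begin

section \<open>The real Banach space of absolutely summable sequences\<close>

typedef ell1 = "{x :: nat \<Rightarrow> real. summable (\<lambda>n. \<bar>x n\<bar>)}"
  morphisms ell1_nth Abs_ell1
  by (rule exI[of _ "\<lambda>_. 0"]) simp

setup_lifting type_definition_ell1

lemma ell1_eqI: "(\<And>n. ell1_nth x n = ell1_nth y n) \<Longrightarrow> x = y"
  by transfer auto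

lemma summable_abs_ell1_nth: "summable (\<lambda>n. \<bar>ell1_nth x n\<bar>)"
  using ell1_nth[of x] by simp

lemma summable_abs_add:
  fixes f g :: "nat \<Rightarrow> real"
  assumes "summable (\<lambda>n. \<bar>f n\<bar>)" "summable (\<lambda>n. \<bar>g n\<bar>)"
  shows "summable (\<lambda>n. \<bar>f n + g n\<bar>)"
  by (rule summable_comparison_test'[OF summable_add[OF assms], of 0])
    (simp add: abs_triangle_ineq)

instantiation ell1 :: real_vector
begin

lift_definition zero_ell1 :: ell1 is "\<lambda>_. 0"
  by simp

lift_definition plus_ell1 :: "ell1 \<Rightarrow> ell1 \<Rightarrow> ell1" is "\<lambda>x y n. x n + y n"
  by (rule summable_abs_add)

lift_definition uminus_ell1 :: "ell1 \<Rightarrow> ell1" is "\<lambda>x n. - x n"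
  by simp

lift_definition minus_ell1 :: "ell1 \<Rightarrow> ell1 \<Rightarrow> ell1" is "\<lambda>x y n. x n - y n"
  using summable_abs_add[of _ "\<lambda>n. - _ n"] by fastforce

lift_definition scaleR_ell1 :: "real \<Rightarrow> ell1 \<Rightarrow> ell1" is "\<lambda>c x n. c * x n"
  by (simp add: abs_mult summable_mult)

instance
  by standard (transfer; simp add: algebra_simps fun_eq_iff)+

end

instantiation ell1 :: real_normed_vector
begin

lift_definition norm_ell1 :: "ell1 \<Rightarrow> real" is "\<lambda>x. \<Sum>n. \<bar>x n\<bar>" .

definition dist_ell1 :: "ell1 \<Rightarrow> ell1 \<Rightarrow> real"
  where "dist_ell1 x y = norm (x - y)"

definition sgn_ell1 :: "ell1 \<Rightarrow> ell1"
  where "sgn_ell1 x = x /\<^sub>R norm x"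

definition uniformity_ell1 :: "(ell1 \<times> ell1) filter"
  where "uniformity_ell1 = (INF e\<in>{0<..}. principal {(x, y). dist x y < e})"

definition open_ell1 :: "ell1 set \<Rightarrow> bool"
  where "open_ell1 U = (\<forall>x\<in>U. \<forall>\<^sub>F (x', y) in uniformity. x' = x \<longrightarrow> y \<in> U)"

instance
proof
  fix x y :: ell1 and c :: real
  show "norm x = 0 \<longleftrightarrow> x = 0"
    by transfer (auto simp: suminf_eq_zero_iff)
  show "norm (x + y) \<le> norm x + norm y"
  proof transfer
    fix f g :: "nat \<Rightarrow> real"
    assume f: "summable (\<lambda>n. \<bar>f n\<bar>)" and g: "summable (\<lambda>n. \<bar>g n\<bar>)"
    have "(\<Sum>n. \<bar>f n + g n\<bar>) \<le> (\<Sum>n. \<bar>f n\<bar> + \<bar>g n\<bar>)"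
      by (intro suminf_le abs_triangle_ineq summable_abs_add summable_add f g)
    then show "(\<Sum>n. \<bar>f n + g n\<bar>) \<le> (\<Sum>n. \<bar>f n\<bar>) + (\<Sum>n. \<bar>g n\<bar>)"
      by (simp add: suminf_add[OF f g])
  qed
  show "norm (c *\<^sub>R x) = \<bar>c\<bar> * norm x"
    by transfer (simp add: abs_mult suminf_mult)
qed (simp_all add: dist_ell1_def sgn_ell1_def uniformity_ell1_def open_ell1_def)

end

lemma ell1_nth_zero [simp]: "ell1_nth 0 n = 0"
  by transfer simp

lemma ell1_nth_add [simp]: "ell1_nth (x + y) n = ell1_nth x n + ell1_nth y n"
  by transfer simp

lemma ell1_nth_minus [simp]: "ell1_nth (- x) n = - ell1_nth x n"
  by transfer simp

lemma ell1_nth_diff [simp]: "ell1_nth (x - y) n = ell1_nth x n - ell1_nth y n"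
  by transfer simp

lemma ell1_nth_scaleR [simp]: "ell1_nth (c *\<^sub>R x) n = c * ell1_nth x n"
  by transfer simp

lemma norm_ell1_eq: "norm x = (\<Sum>n. \<bar>ell1_nth x n\<bar>)"
  by transfer simp

lemma sum_abs_le_norm_ell1: "(\<Sum>n<N. \<bar>ell1_nth x n\<bar>) \<le> norm x"
  unfolding norm_ell1_eq by (rule sum_le_suminf[OF summable_abs_ell1_nth]) auto

lemma abs_ell1_nth_le_norm: "\<bar>ell1_nth x n\<bar> \<le> norm x"
proof -
  have "\<bar>ell1_nth x n\<bar> \<le> (\<Sum>k<Suc n. \<bar>ell1_nth x k\<bar>)"
    by (simp add: sum_nonneg)
  then show ?thesis
    using sum_abs_le_norm_ell1[of x "Suc n"] by linarith
qed

instance ell1 :: banach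
proof
  fix X :: "nat \<Rightarrow> ell1"
  assume "Cauchy X"
  have "Cauchy (\<lambda>k. ell1_nth (X k) n)" for n
  proof (rule metric_CauchyI)
    fix e :: real assume "e > 0"
    then obtain M where M: "\<forall>j\<ge>M. \<forall>k\<ge>M. dist (X j) (X k) < e"
      using \<open>Cauchy X\<close> unfolding Cauchy_def by blast
    have "dist (ell1_nth (X j) n) (ell1_nth (X k) n) \<le> dist (X j) (X k)" for j k
      using abs_ell1_nth_le_norm[of "X j - X k" n] by (simp add: dist_norm)
    then show "\<exists>M. \<forall>j\<ge>M. \<forall>k\<ge>M. dist (ell1_nth (X j) n) (ell1_nth (X k) n) < e"
      using M le_less_trans by blast
  qed
  then obtain l where l: "\<And>n. (\<lambda>k. ell1_nth (X k) n) \<longlonglongrightarrow> l n"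
    unfolding Cauchy_convergent_iff convergent_def by metis
  have partial: "(\<Sum>n<N. \<bar>ell1_nth (X j) n - l n\<bar>) \<le> e"
    if M: "\<forall>j\<ge>M. \<forall>k\<ge>M. dist (X j) (X k) < e" and "j \<ge> M" for M e j N
  proof (rule tendsto_upperbound)
    show "(\<lambda>k. \<Sum>n<N. \<bar>ell1_nth (X j) n - ell1_nth (X k) n\<bar>)
            \<longlonglongrightarrow> (\<Sum>n<N. \<bar>ell1_nth (X j) n - l n\<bar>)"
      by (intro tendsto_intros l)
    have "(\<Sum>n<N. \<bar>ell1_nth (X j) n - ell1_nth (X k) n\<bar>) \<le> e" if "k \<ge> M" for k
      using sum_abs_le_norm_ell1[where x = "X j - X k" and N = N] M \<open>j \<ge> M\<close> that
      by (fastforce simp: dist_norm)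
    then show "\<forall>\<^sub>F k in sequentially.
        (\<Sum>n<N. \<bar>ell1_nth (X j) n - ell1_nth (X k) n\<bar>) \<le> e"
      unfolding eventually_sequentially by blast
  qed simp
  have diff: "summable (\<lambda>n. \<bar>ell1_nth (X j) n - l n\<bar>) \<and> (\<Sum>n. \<bar>ell1_nth (X j) n - l n\<bar>) \<le> e"
    if "\<forall>j\<ge>M. \<forall>k\<ge>M. dist (X j) (X k) < e" and "j \<ge> M" for M e j
  proof -
    have "summable (\<lambda>n. \<bar>ell1_nth (X j) n - l n\<bar>)"
      using partial[OF that] by (intro summableI_nonneg_bounded[of _ e]) auto
    then show ?thesis
      using partial[OF that] suminf_le_const by blast
  qed
  obtain M where "\<forall>j\<ge>M. \<forall>k\<ge>M. dist (X j) (X k) < 1"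
    using \<open>Cauchy X\<close> unfolding Cauchy_def by (meson zero_less_one)
  then have "summable (\<lambda>n. \<bar>ell1_nth (X M) n - l n\<bar>)"
    using diff[of M 1 M] by blast
  then have "summable (\<lambda>n. \<bar>l n - ell1_nth (X M) n\<bar>)"
    by (simp add: abs_minus_commute)
  from summable_abs_add[OF this summable_abs_ell1_nth[of "X M"]]
  have "summable (\<lambda>n. \<bar>l n\<bar>)"
    by simp
  then have L: "ell1_nth (Abs_ell1 l) = l"
    by (simp add: Abs_ell1_inverse)
  have "X \<longlonglongrightarrow> Abs_ell1 l"
  proof (rule metric_LIMSEQ_I)
    fix e :: real assume "e > 0"
    then obtain M where "\<forall>j\<ge>M. \<forall>k\<ge>M. dist (X j) (X k) < e / 2"
      using \<open>Cauchy X\<close> unfolding Cauchy_def by (meson half_gt_zero)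
    from diff[OF this] have "dist (X j) (Abs_ell1 l) \<le> e / 2" if "j \<ge> M" for j
      using that by (simp add: dist_norm norm_ell1_eq L)
    then show "\<exists>M. \<forall>j\<ge>M. dist (X j) (Abs_ell1 l) < e"
      using \<open>e > 0\<close> by (intro exI[of _ M]) fastforce
  qed
  then show "convergent X"
    by (rule convergentI)
qed

section \<open>Continuous quadratic forms and delta-convex functions\<close>

definition continuous_quadratic_form :: "('a::banach \<Rightarrow> real) \<Rightarrow> bool"
  where "continuous_quadratic_form q \<longleftrightarrow>
    (\<exists>b :: 'a \<Rightarrow> 'a \<Rightarrow> real. bilinear b \<and> continuous_on UNIV (\<lambda>(x, y). b x y) \<and>
      (\<forall>x. q x = b x x))"

definition delta_convex :: "('a::banach \<Rightarrow> real) \<Rightarrow> bool"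
  where "delta_convex f \<longleftrightarrow>
    (\<exists>g h :: 'a \<Rightarrow> real. convex_on UNIV g \<and> continuous_on UNIV g \<and>
      convex_on UNIV h \<and> continuous_on UNIV h \<and> (\<forall>x. f x = g x - h x))"

end

theory Submission
  imports Defs
begin

text \<open>
  A delta-convex function \<open>q = g - h\<close> is controlled by the convex function \<open>f = g + h\<close>: at every
  midpoint the Jensen gap of \<open>f\<close> is at least the absolute value of the Jensen gap of \<open>q\<close>, because
  the gaps of \<open>g\<close> and \<open>h\<close> are nonnegative and add up for \<open>f\<close> where they are subtracted for \<open>q\<close>.
  Consider a dyadic tree of vectors, each being the midpoint of its two children, and suppose that
  the Jensen gap of \<open>q\<close> has absolute value at least \<open>\<delta>\<close> at every node, with whatever sign. Walking
  from the root to a leaf, always towards the child where \<open>f\<close> is larger, \<open>f\<close> gains \<open>\<delta>\<close> at each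
  step. If there are such trees of every height in the unit ball and \<open>q\<close> is quadratic, so that the
  trees can be shrunk into a ball on which \<open>f\<close> is bounded, then \<open>q\<close> is not delta-convex. (These
  trees are the dyadic martingales that show the failure of the UMD property.)

  In \<open>\<ell>\<^sub>1\<close> the averages of the unit vectors over dyadic blocks of indices form such trees, and every
  bounded kernel is the matrix of a continuous bilinear form. The kernel is chosen self-similar:
  its average over each pair of blocks of length 2 is the kernel itself with the opposite sign.
  Therefore the quadratic form alternates between \<open>1\<close> and \<open>-1\<close> along the levels of the tree, and
  all Jensen gaps are \<open>2\<close> or \<open>-2\<close>.
\<close>

section \<open>Dyadic trees and delta-convexity\<close>

lemma delta_convex_control:
  fixes q :: "'a::banach \<Rightarrow> real"
  assumes "delta_convex q"
  obtains f :: "'a \<Rightarrow> real" where "continuous_on UNIV f"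
    and "\<And>x y. \<bar>(q x + q y) / 2 - q ((1/2) *\<^sub>R (x + y))\<bar>
                 \<le> (f x + f y) / 2 - f ((1/2) *\<^sub>R (x + y))"
proof -
  obtain g h where g: "convex_on UNIV g" "continuous_on UNIV g"
    and h: "convex_on UNIV h" "continuous_on UNIV h" and q: "\<And>x. q x = g x - h x"
    using assms unfolding delta_convex_def by blast
  have mid: "k ((1/2) *\<^sub>R (x + y)) \<le> (k x + k y) / 2"
    if "convex_on UNIV k" for k :: "'a \<Rightarrow> real" and x y
    using convex_onD[OF that, of "1/2" x y] by (simp add: scaleR_add_right)
  show thesis
  proof (rule that[of "\<lambda>x. g x + h x"])
    show "continuous_on UNIV (\<lambda>x. g x + h x)"
      by (intro continuous_on_add g h)
    fix x y :: 'a
    show "\<bar>(q x + q y) / 2 - q ((1/2) *\<^sub>R (x + y))\<bar>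
            \<le> (g x + h x + (g y + h y)) / 2
              - (g ((1/2) *\<^sub>R (x + y)) + h ((1/2) *\<^sub>R (x + y)))"
      using mid[OF g(1), of x y] mid[OF h(1), of x y] by (simp add: q abs_le_iff field_simps)
  qed
qed

text \<open>
  The vectors \<open>u m k\<close> are the nodes at height \<open>k\<close> above the leaves \<open>u i 0\<close>; the children of
  \<open>u m (Suc k)\<close> are \<open>u (2 * m) k\<close> and \<open>u (2 * m + 1) k\<close>.
\<close>
lemma not_delta_convex_if_dyadic_tree:
  fixes q :: "'a::banach \<Rightarrow> real" and u :: "nat \<Rightarrow> nat \<Rightarrow> 'a"
  assumes homogeneous: "\<And>c x. q (c *\<^sub>R x) = c\<^sup>2 * q x"
    and tree: "\<And>m k. u m (Suc k) = (1/2) *\<^sub>R (u (2 * m) k + u (2 * m + 1) k)"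
    and bounded: "\<And>m k. norm (u m k) \<le> 1"
    and "\<delta> > 0"
    and gap: "\<And>m k. \<delta> \<le> \<bar>(q (u (2 * m) k) + q (u (2 * m + 1) k)) / 2 - q (u m (Suc k))\<bar>"
  shows "\<not> delta_convex q"
proof
  assume "delta_convex q"
  then obtain f :: "'a \<Rightarrow> real" where cont: "continuous_on UNIV f"
    and control: "\<And>x y. \<bar>(q x + q y) / 2 - q ((1/2) *\<^sub>R (x + y))\<bar>
                          \<le> (f x + f y) / 2 - f ((1/2) *\<^sub>R (x + y))"
    using delta_convex_control by blast
  have "isCont f 0"
    using cont continuous_on_eq_continuous_at open_UNIV by blast
  then obtain s where "s > 0" and s: "\<And>x. norm x < s \<Longrightarrow> \<bar>f x - f 0\<bar> < 1"
    unfolding continuous_at_eps_delta by (metis dist_norm diff_zero real_norm_def zero_less_one)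
  define r where "r = s / 2"
  have "r > 0"
    using \<open>s > 0\<close> by (simp add: r_def)
  have near: "\<bar>f (r *\<^sub>R u m k) - f 0\<bar> < 1" for m k
  proof (rule s)
    have "norm (r *\<^sub>R u m k) \<le> r * 1"
      using bounded[of m k] \<open>r > 0\<close> by simp
    then show "norm (r *\<^sub>R u m k) < s"
      using \<open>s > 0\<close> by (simp add: r_def)
  qed
  have step: "f (r *\<^sub>R u m (Suc k)) + r\<^sup>2 * \<delta>
      \<le> max (f (r *\<^sub>R u (2 * m) k)) (f (r *\<^sub>R u (2 * m + 1) k))" for m k
  proof -
    let ?x = "u (2 * m) k" and ?y = "u (2 * m + 1) k"
    have mid: "(1/2) *\<^sub>R (r *\<^sub>R ?x + r *\<^sub>R ?y) = r *\<^sub>R u m (Suc k)"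
      by (simp add: tree scaleR_add_right mult.commute)
    have "r\<^sup>2 * \<delta> \<le> r\<^sup>2 * \<bar>(q ?x + q ?y) / 2 - q (u m (Suc k))\<bar>"
      by (intro mult_left_mono gap) simp
    also have "\<dots> = \<bar>r\<^sup>2 * ((q ?x + q ?y) / 2 - q (u m (Suc k)))\<bar>"
      by (simp add: abs_mult)
    also have "\<dots> = \<bar>(q (r *\<^sub>R ?x) + q (r *\<^sub>R ?y)) / 2 - q (r *\<^sub>R u m (Suc k))\<bar>"
      by (simp only: homogeneous) (simp add: algebra_simps add_divide_distrib)
    also have "\<dots> \<le> (f (r *\<^sub>R ?x) + f (r *\<^sub>R ?y)) / 2 - f (r *\<^sub>R u m (Suc k))"
      using control[of "r *\<^sub>R ?x" "r *\<^sub>R ?y"] by (simp only: mid)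
    finally show ?thesis
      unfolding le_max_iff_disj by argo
  qed
  have climb: "\<exists>i. f (r *\<^sub>R u m k) + real k * (r\<^sup>2 * \<delta>) \<le> f (r *\<^sub>R u i 0)" for m k
  proof (induction k arbitrary: m)
    case 0
    then show ?case by auto
  next
    case (Suc k)
    obtain m' where m': "f (r *\<^sub>R u m (Suc k)) + r\<^sup>2 * \<delta> \<le> f (r *\<^sub>R u m' k)"
      using step[of m k] by (auto simp: le_max_iff_disj)
    obtain i where "f (r *\<^sub>R u m' k) + real k * (r\<^sup>2 * \<delta>) \<le> f (r *\<^sub>R u i 0)"
      using Suc.IH by blast
    with m' have "f (r *\<^sub>R u m (Suc k)) + real (Suc k) * (r\<^sup>2 * \<delta>) \<le> f (r *\<^sub>R u i 0)"
      by (simp add: distrib_right)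
    then show ?case ..
  qed
  \<comment> \<open>All values of \<open>f\<close> on the shrunken tree differ from \<open>f 0\<close> by less than 1, so a gain of 2
    is impossible.\<close>
  obtain k where k: "2 < real k * (r\<^sup>2 * \<delta>)"
    using reals_Archimedean3[of "r\<^sup>2 * \<delta>"] \<open>r > 0\<close> \<open>\<delta> > 0\<close> by auto
  obtain i where "f (r *\<^sub>R u 0 k) + real k * (r\<^sup>2 * \<delta>) \<le> f (r *\<^sub>R u i 0)"
    using climb by blast
  with k near[of 0 k] near[of i 0] show False
    by linarith
qed

section \<open>Bilinear forms on \<open>\<ell>\<^sub>1\<close> given by bounded kernels\<close>

definition kernel_form :: "(nat \<Rightarrow> nat \<Rightarrow> real) \<Rightarrow> ell1 \<Rightarrow> ell1 \<Rightarrow> real"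
  where "kernel_form c x y = (\<Sum>i. ell1_nth x i * (\<Sum>j. c i j * ell1_nth y j))"

lemma summable_bounded_mult_ell1:
  assumes "\<And>n. \<bar>d n\<bar> \<le> C"
  shows "summable (\<lambda>n. d n * ell1_nth x n)"
    and "\<bar>\<Sum>n. d n * ell1_nth x n\<bar> \<le> C * norm x"
proof -
  have le: "\<bar>d n * ell1_nth x n\<bar> \<le> C * \<bar>ell1_nth x n\<bar>" for n
    using assms[of n] by (simp add: abs_mult mult_right_mono)
  have maj: "summable (\<lambda>n. C * \<bar>ell1_nth x n\<bar>)"
    by (intro summable_mult summable_abs_ell1_nth)
  have abs: "summable (\<lambda>n. \<bar>d n * ell1_nth x n\<bar>)"
    by (rule summable_comparison_test'[OF maj, of 0]) (use le in simp)
  then show "summable (\<lambda>n. d n * ell1_nth x n)"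
    by (rule summable_rabs_cancel)
  have "\<bar>\<Sum>n. d n * ell1_nth x n\<bar> \<le> (\<Sum>n. \<bar>d n * ell1_nth x n\<bar>)"
    by (rule summable_rabs[OF abs])
  also have "\<dots> \<le> (\<Sum>n. C * \<bar>ell1_nth x n\<bar>)"
    by (rule suminf_le[OF le abs maj])
  also have "\<dots> = C * norm x"
    by (simp add: norm_ell1_eq suminf_mult summable_abs_ell1_nth)
  finally show "\<bar>\<Sum>n. d n * ell1_nth x n\<bar> \<le> C * norm x" .
qed

lemma bounded_bilinear_kernel_form:
  assumes c: "\<And>i j. \<bar>c i j\<bar> \<le> C"
  shows "bounded_bilinear (kernel_form c)"
proof -
  define T where "T y i = (\<Sum>j. c i j * ell1_nth y j)" for y i
  have T_add: "T (y + z) i = T y i + T z i" for y z i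
    by (simp add: T_def distrib_left suminf_add summable_bounded_mult_ell1[OF c])
  have T_scale: "T (a *\<^sub>R y) i = a * T y i" for a y i
    by (simp add: T_def mult.left_commute suminf_mult summable_bounded_mult_ell1[OF c])
  have T_bound: "\<bar>T y i\<bar> \<le> C * norm y" for y i
    unfolding T_def by (rule summable_bounded_mult_ell1[OF c])
  have form: "kernel_form c x y = (\<Sum>i. T y i * ell1_nth x i)" for x y
    by (simp add: kernel_form_def T_def mult.commute)
  have sums: "summable (\<lambda>i. T y i * ell1_nth x i)" for x y
    by (rule summable_bounded_mult_ell1[OF T_bound])
  show ?thesis
  proof
    show "kernel_form c (x + x') y = kernel_form c x y + kernel_form c x' y" for x x' y
      by (simp add: form distrib_left suminf_add sums)
    show "kernel_form c x (y + y') = kernel_form c x y + kernel_form c x y'" for x y y'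
      by (simp add: form T_add distrib_right suminf_add sums)
    show "kernel_form c (a *\<^sub>R x) y = a *\<^sub>R kernel_form c x y" for a x y
      by (simp add: form mult.left_commute suminf_mult sums)
    show "kernel_form c x (a *\<^sub>R y) = a *\<^sub>R kernel_form c x y" for a x y
      by (simp add: form T_scale mult.assoc suminf_mult sums)
    have "norm (kernel_form c x y) \<le> norm x * norm y * C" for x y
      using summable_bounded_mult_ell1(2)[OF T_bound[of y], where x = x] by (simp add: form ac_simps)
    then show "\<exists>K. \<forall>x y. norm (kernel_form c x y) \<le> norm x * norm y * K"
      by blast
  qed
qed

lift_definition unit_vector :: "nat \<Rightarrow> ell1" is "\<lambda>m n. if n = m then 1 else 0"
  by (rule summable_finite[of "{_}"]) auto

lemma suminf_mult_unit_vector: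
  fixes d :: "nat \<Rightarrow> real"
  shows "(\<Sum>n. d n * ell1_nth (unit_vector m) n) = d m"
proof -
  have "(\<Sum>n. d n * ell1_nth (unit_vector m) n) = (\<Sum>n\<in>{m}. d n * ell1_nth (unit_vector m) n)"
    by (rule suminf_finite) (auto simp: unit_vector.rep_eq)
  then show ?thesis
    by (simp add: unit_vector.rep_eq)
qed

lemma kernel_form_unit_vector: "kernel_form c (unit_vector i) (unit_vector j) = c i j"
  by (simp add: kernel_form_def suminf_mult_unit_vector)
     (simp add: mult.commute[of "ell1_nth _ _"] suminf_mult_unit_vector)

lemma norm_unit_vector: "norm (unit_vector m) = 1"
proof -
  have "norm (unit_vector m) = (\<Sum>n. 1 * ell1_nth (unit_vector m) n)"
    unfolding norm_ell1_eq by (rule suminf_cong) (simp add: unit_vector.rep_eq)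
  then show ?thesis
    by (simp only: suminf_mult_unit_vector)
qed

text \<open>The vector \<open>block_average m k\<close> is the mean of the unit vectors with indices
  \<open>i\<close> such that \<open>i div 2 ^ k = m\<close>.\<close>
fun block_average :: "nat \<Rightarrow> nat \<Rightarrow> ell1" where
  "block_average m 0 = unit_vector m"
| "block_average m (Suc k) =
     (1/2) *\<^sub>R (block_average (2 * m) k + block_average (2 * m + 1) k)"

lemma norm_block_average_le: "norm (block_average m k) \<le> 1"
proof (induction k arbitrary: m)
  case 0
  then show ?case by (simp add: norm_unit_vector)
next
  case (Suc k)
  show ?case
    using norm_triangle_ineq[of "block_average (2 * m) k" "block_average (2 * m + 1) k"]
      Suc.IH[of "2 * m"] Suc.IH[of "2 * m + 1"] by simp
qed

section \<open>A kernel that changes sign under dyadic averaging\<close>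

text \<open>
  For distinct indices the value is \<open>3\<close> or \<open>-3\<close>, according to the parity of the level at which
  their dyadic blocks merge. The value \<open>-3\<close> at siblings turns the average over a diagonal
  \<open>2 \<times> 2\<close> block into \<open>(1 - 3 - 3 + 1) / 4 = -1\<close>, the opposite of the diagonal entry.
\<close>
function alternating_kernel :: "nat \<Rightarrow> nat \<Rightarrow> real" where
  "alternating_kernel i j =
     (if i = j then 1 else if i div 2 = j div 2 then -3
      else - alternating_kernel (i div 2) (j div 2))"
  by pat_completeness auto
termination
  by (relation "Wellfounded.measure (\<lambda>(i, j). i + j)") auto

declare alternating_kernel.simps [simp del]

lemma abs_alternating_kernel_le: "\<bar>alternating_kernel i j\<bar> \<le> 3"
proof (induction i j rule: alternating_kernel.induct)
  case (1 i j)
  then show ?case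
    by (subst alternating_kernel.simps) auto
qed

lemma alternating_kernel_average:
  "(alternating_kernel (2 * m) (2 * n) + alternating_kernel (2 * m) (2 * n + 1)
    + alternating_kernel (2 * m + 1) (2 * n) + alternating_kernel (2 * m + 1) (2 * n + 1)) / 4
   = - alternating_kernel m n"
proof (cases "m = n")
  case True
  have "2 * n \<noteq> 2 * n + 1" "2 * n + 1 \<noteq> 2 * n"
    by simp_all
  then show ?thesis
    unfolding True by (simp add: alternating_kernel.simps)
next
  case False
  then have "alternating_kernel i j = - alternating_kernel m n"
    if "i div 2 = m" "j div 2 = n" for i j
    using that by (subst alternating_kernel.simps) auto
  then show ?thesis
    by simp
qed

lemma kernel_form_block_average:
  "kernel_form alternating_kernel (block_average m k) (block_average n k)
   = (-1) ^ k * alternating_kernel m n"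
proof (induction k arbitrary: m n)
  case 0
  then show ?case by (simp add: kernel_form_unit_vector)
next
  case (Suc k)
  interpret bounded_bilinear "kernel_form alternating_kernel"
    by (rule bounded_bilinear_kernel_form[OF abs_alternating_kernel_le])
  have "kernel_form alternating_kernel (block_average m (Suc k)) (block_average n (Suc k))
      = (-1) ^ k *
        ((alternating_kernel (2 * m) (2 * n) + alternating_kernel (2 * m) (2 * n + 1)
          + alternating_kernel (2 * m + 1) (2 * n)
          + alternating_kernel (2 * m + 1) (2 * n + 1)) / 4)"
    unfolding block_average.simps
    by (simp only: scaleR_left scaleR_right add_left add_right Suc.IH real_scaleR_def)
       (simp add: field_simps)
  also have "\<dots> = (-1) ^ Suc k * alternating_kernel m n"
    by (simp only: alternating_kernel_average) simp
  finally show ?case .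
qed

theorem theorem2p14:
  shows "\<exists>q :: ell1 \<Rightarrow> real. continuous_quadratic_form q \<and> \<not> delta_convex q"
proof -
  define b where "b = kernel_form alternating_kernel"
  define q where "q x = b x x" for x
  interpret b: bounded_bilinear b
    unfolding b_def by (rule bounded_bilinear_kernel_form[OF abs_alternating_kernel_le])
  have "continuous_on UNIV (\<lambda>(x, y). b x y)"
    unfolding case_prod_unfold by (intro b.continuous_on continuous_intros)
  moreover have "bilinear b"
    unfolding bilinear_def
    by (intro allI conjI bounded_linear.linear b.bounded_linear_left b.bounded_linear_right)
  ultimately have quadratic: "continuous_quadratic_form q"
    unfolding continuous_quadratic_form_def q_def by blast
  have q_block: "q (block_average m k) = (-1) ^ k" for m k
    by (simp only: q_def b_def kernel_form_block_average) (simp add: alternating_kernel.simps)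
  have "\<not> delta_convex q"
  proof (rule not_delta_convex_if_dyadic_tree[where u = block_average and \<delta> = 2])
    show "q (c *\<^sub>R x) = c\<^sup>2 * q x" for c x
      by (simp add: q_def b.scaleR_left b.scaleR_right power2_eq_square)
    show "2 \<le> \<bar>(q (block_average (2 * m) k) + q (block_average (2 * m + 1) k)) / 2
               - q (block_average m (Suc k))\<bar>" for m k
      by (simp only: q_block) (simp add: abs_mult)
  qed (simp_all add: norm_block_average_le)
  with quadratic show ?thesis
    by blast
qed

end
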